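(* For $n\ge1$ and $b\in\{1,2\}$, $$|\widehat{\mathrm{PF}}_n^b| = \dim_k\left(\frac{R}{I_{T_b}^{[\mathbf{n}]}}\right) = s(n+1,2),$$ where $s(n+1,2)$ is the signless Stirling number of the first kind.
   Context: $k$ a field, $R=k[x_1,\ldots,x_n]$. $T_1 = \mathfrak{S}_n(123,132,231)$, $T_2=\mathfrak{S}_n(213,312,321)$: permutations of $[n]$ (one-line notation) with no subsequence in the same relative order as a listed pattern. $I_S=\langle\prod_i x_i^{\sigma(i)}:\sigma\in S\rangle$; $I^{[\mathbf{n}]}$ is the Alexander dual with respect to $\mathbf{n}=(n,\ldots,n)$: $I^{[\mathbf{n}]} = \bigcap_{\mathbf{x}^{\mathbf{b}}}\langle x_i^{n+1-b_i}: b_i\ge1\rangle$ over minimal generators $\mathbf{x}^{\mathbf{b}}$ of $I$. A parking function of length $n$ is $\mathbf{p}\in\mathbb{N}^n$ whose nondecreasing rearrangement $p_{i_1}\le\cdots\le p_{i_n}$ satisfies $p_{i_j}<j$; $\mathrm{PF}_n$ is the set of these. $\widehat{\mathrm{PF}}_n^1 = \{\mathbf{p}\in\mathrm{PF}_n : p_t\le t\ \forall t, \text{ and if } p_i=i \text{ then } p_n<i\}$; $\widehat{\mathrm{PF}}_n^2 = \{\mathbf{p}\in\mathrm{PF}_n : p_{n-t}\le t\ \forall t, \text{ and if } p_{n-i}=i \text{ then } p_n<i\}$. $s(n+1,2)$ is the number of permutations of $[n+1]$ with exactly two cycles. *)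

theory Defs
  imports
    "HOL-Library.Poly_Mapping"
    "HOL-Library.FuncSet"
    "HOL-Algebra.Embedded_Algebras"
    "HOL-Algebra.QuotRing"
    "HOL-Combinatorics.Orbits"
begin

text \<open>A permutation of \<open>[n]\<close> is a function \<open>\<sigma>\<close> with \<open>\<sigma> permutes {1..n}\<close>, standing for the word
  \<open>\<sigma>(1) \<dots> \<sigma>(n)\<close>; a pattern is given by its one-line notation as a list. The function \<open>f\<close> selects
  the (1-based) positions of the subsequence.\<close>

definition contains_pattern :: "nat \<Rightarrow> (nat \<Rightarrow> nat) \<Rightarrow> nat list \<Rightarrow> bool" where
  "contains_pattern n \<sigma> \<tau> \<longleftrightarrow>
     (\<exists>f. strict_mono_on {..<length \<tau>} f \<and> f ` {..<length \<tau>} \<subseteq> {1..n} \<and>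
          (\<forall>a<length \<tau>. \<forall>b<length \<tau>. \<sigma> (f a) < \<sigma> (f b) \<longleftrightarrow> \<tau> ! a < \<tau> ! b))"

definition avoiding :: "nat \<Rightarrow> nat list set \<Rightarrow> (nat \<Rightarrow> nat) set" where
  "avoiding n P = {\<sigma>. \<sigma> permutes {1..n} \<and> (\<forall>\<tau>\<in>P. \<not> contains_pattern n \<sigma> \<tau>)}"

text \<open>Only \<open>b = 1\<close> and \<open>b = 2\<close> are meaningful, here and in \<open>PF_hat\<close> below.\<close>

definition T :: "nat \<Rightarrow> nat \<Rightarrow> (nat \<Rightarrow> nat) set" where
  "T b n = (if b = 1 then avoiding n {[1,2,3], [1,3,2], [2,3,1]}
            else avoiding n {[2,1,3], [3,1,2], [3,2,1]})"

text \<open>A polynomial maps exponent vectors, which are finitely supported functions on variable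
  indices, to coefficients. The ring in the variables \<open>x\<^sub>1, \<dots>, x\<^sub>n\<close> is carved out of the ring in
  countably many variables.\<close>

type_synonym 'k mpoly = "(nat \<Rightarrow>\<^sub>0 nat) \<Rightarrow>\<^sub>0 'k"

definition poly_ring :: "nat \<Rightarrow> 'k::field mpoly ring" where
  "poly_ring n = \<lparr>carrier = {p. \<forall>m\<in>Poly_Mapping.keys p. Poly_Mapping.keys m \<subseteq> {1..n}},
                  monoid.mult = (*), one = 1, zero = 0, add = (+)\<rparr>"

lemma poly_ring_simps:
  "a \<otimes>\<^bsub>poly_ring n\<^esub> b = a * b" "a \<oplus>\<^bsub>poly_ring n\<^esub> b = a + b"
  "\<one>\<^bsub>poly_ring n\<^esub> = 1" "\<zero>\<^bsub>poly_ring n\<^esub> = 0"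
  by (simp_all add: poly_ring_def)

lemma carrier_poly_ring_iff:
  "p \<in> carrier (poly_ring n) \<longleftrightarrow> (\<forall>m\<in>Poly_Mapping.keys p. Poly_Mapping.keys m \<subseteq> {1..n})"
  by (simp add: poly_ring_def)

lemma poly_ring_closed:
  fixes p q :: "'k::field mpoly"
  assumes "p \<in> carrier (poly_ring n)" "q \<in> carrier (poly_ring n)"
  shows "p + q \<in> carrier (poly_ring n)" "p * q \<in> carrier (poly_ring n)"
    "- p \<in> carrier (poly_ring n)"
proof -
  show "p + q \<in> carrier (poly_ring n)"
    using assms Poly_Mapping.keys_add[of p q] unfolding carrier_poly_ring_iff by blast
  show "- p \<in> carrier (poly_ring n)"
    using assms unfolding carrier_poly_ring_iff by simp
  show "p * q \<in> carrier (poly_ring n)"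
    unfolding carrier_poly_ring_iff
  proof
    fix m assume "m \<in> Poly_Mapping.keys (p * q)"
    then obtain a b where m: "m = a + b" and
        ab: "a \<in> Poly_Mapping.keys p" "b \<in> Poly_Mapping.keys q"
      using Poly_Mapping.keys_mult[of p q] by blast
    have "Poly_Mapping.keys a \<union> Poly_Mapping.keys b \<subseteq> {1..n}"
      using ab assms unfolding carrier_poly_ring_iff by blast
    then show "Poly_Mapping.keys m \<subseteq> {1..n}"
      unfolding m using Poly_Mapping.keys_add[of a b] by (rule order_trans[rotated])
  qed
qed

lemma cring_poly_ring: "cring (poly_ring n :: 'k::field mpoly ring)"
proof (rule cringI)
  have zero: "0 \<in> carrier (poly_ring n :: 'k mpoly ring)"
    and one: "1 \<in> carrier (poly_ring n :: 'k mpoly ring)"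
    by (simp_all add: carrier_poly_ring_iff)
  show "abelian_group (poly_ring n :: 'k mpoly ring)"
  proof (rule abelian_groupI, unfold poly_ring_simps)
    fix p :: "'k mpoly" assume "p \<in> carrier (poly_ring n)"
    then show "\<exists>q\<in>carrier (poly_ring n). q + p = 0"
      by (intro bexI[of _ "- p"]) (simp_all add: poly_ring_closed)
  qed (simp_all only: zero poly_ring_closed ac_simps add_0_left add_0_right)
  show "comm_monoid (poly_ring n :: 'k mpoly ring)"
    by (rule comm_monoidI, unfold poly_ring_simps)
      (simp_all only: one poly_ring_closed ac_simps mult_1_left mult_1_right)
qed (simp add: poly_ring_simps distrib_right)

definition var :: "nat \<Rightarrow> 'k::field mpoly" where
  "var i = Poly_Mapping.single (Poly_Mapping.single i 1) 1"

definition perm_ideal :: "nat \<Rightarrow> (nat \<Rightarrow> nat) set \<Rightarrow> 'k::field mpoly set" where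
  "perm_ideal n S = Idl\<^bsub>poly_ring n\<^esub> ((\<lambda>\<sigma>. \<Prod>i=1..n. var i ^ \<sigma> i) ` S)"

text \<open>The exponent vectors of the minimal generators of a monomial ideal: the monomials of the
  ideal that are minimal under divisibility.\<close>

definition min_gens :: "nat \<Rightarrow> 'k::field mpoly set \<Rightarrow> (nat \<Rightarrow>\<^sub>0 nat) set" where
  "min_gens n I =
     {b. Poly_Mapping.keys b \<subseteq> {1..n} \<and> Poly_Mapping.single b 1 \<in> I \<and>
         (\<forall>c. Poly_Mapping.single c 1 \<in> I \<and>
              (\<forall>i. Poly_Mapping.lookup c i \<le> Poly_Mapping.lookup b i) \<longrightarrow> c = b)}"

text \<open>As usual for the Alexander dual, \<open>a\<close> must bound the exponent vectors of all minimal
  generators; otherwise the subtraction truncates.\<close>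

definition alexander_dual ::
  "nat \<Rightarrow> (nat \<Rightarrow> nat) \<Rightarrow> 'k::field mpoly set \<Rightarrow> 'k mpoly set" where
  "alexander_dual n a I =
     carrier (poly_ring n) \<inter>
     (\<Inter>b\<in>min_gens n I.
        Idl\<^bsub>poly_ring n\<^esub> {var i ^ (a i + 1 - Poly_Mapping.lookup b i) | i.
                          i \<in> {1..n} \<and> Poly_Mapping.lookup b i \<ge> 1})"

text \<open>The copy of the coefficient field in the quotient of the polynomial ring by \<open>I\<close>; it consists
  of the scalars of the quotient as a vector space.\<close>

definition quot_scalars :: "nat \<Rightarrow> 'k::field mpoly set \<Rightarrow> 'k mpoly set set" where
  "quot_scalars n I = range (\<lambda>c. I +>\<^bsub>poly_ring n\<^esub> Poly_Mapping.single 0 c)"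

text \<open>Vectors in \<open>\<nat>\<^sup>n\<close> are functions on \<open>{1..n}\<close>, extensional so that they can be counted. After
  sorting, the \<open>j\<close>-th entry is at list position \<open>j - 1\<close>.\<close>

definition PF :: "nat \<Rightarrow> (nat \<Rightarrow> nat) set" where
  "PF n = {p \<in> {1..n} \<rightarrow>\<^sub>E UNIV. \<forall>j\<in>{1..n}. sort (map p [1..<Suc n]) ! (j - 1) < j}"

text \<open>In the second family \<open>t\<close> and \<open>i\<close> range over \<open>1, \<dots>, n - 1\<close>: the index \<open>n - t\<close> must lie in
  \<open>{1..n}\<close>, and for \<open>t = i = 0\<close> the two conditions \<open>p\<^sub>n \<le> 0\<close> and \<open>p\<^sub>n = 0 \<longrightarrow> p\<^sub>n < 0\<close> would
  contradict each other.\<close>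

definition PF_hat :: "nat \<Rightarrow> nat \<Rightarrow> (nat \<Rightarrow> nat) set" where
  "PF_hat b n =
     (if b = 1
      then {p \<in> PF n. (\<forall>t\<in>{1..n}. p t \<le> t) \<and> (\<forall>i\<in>{1..n}. p i = i \<longrightarrow> p n < i)}
      else {p \<in> PF n. (\<forall>t\<in>{1..<n}. p (n - t) \<le> t) \<and> (\<forall>i\<in>{1..<n}. p (n - i) = i \<longrightarrow> p n < i)})"

text \<open>Fixed points count as cycles: their \<open>orbit\<close> is a singleton.\<close>

definition stirling1 :: "nat \<Rightarrow> nat \<Rightarrow> nat" where
  "stirling1 m k = card {\<pi>. \<pi> permutes {1..m} \<and> card (orbit \<pi> ` {1..m}) = k}"

end

theory Submission
  imports Defs "HOL-Combinatorics.Stirling"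
begin

text \<open>Exponent vectors of permutations have equal coordinate sums, so all of them are minimal
  generators. Hence the monomials outside the Alexander dual of \<open>I\<^sub>S\<close> are the \<open>x\<^sup>p\<close> such that some
  \<open>\<sigma> \<in> S\<close> satisfies \<open>p\<^sub>i + \<sigma>(i) \<le> n\<close> for all \<open>i\<close>, and they form a basis of the quotient.

  The set \<open>T\<^sub>1\<close> (or \<open>T\<^sub>2\<close>) consists of the permutations that decrease (or increase) on the first
  \<open>n - 1\<close> positions, so \<open>\<sigma>\<close> is determined by \<open>\<sigma>(n)\<close> and the standard monomials are a union of \<open>n\<close> boxes.
  This union is the family of restricted parking functions. Those with \<open>p\<^sub>n = m\<close> form
  a box with \<open>n!/(m + 1)\<close> points, and \<open>\<Sum> n!/k\<close> over \<open>1 \<le> k \<le> n\<close> is \<open>s(n + 1, 2)\<close>.\<close>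

section \<open>Cycle counts of permutations\<close>

text \<open>On cycles, \<open>transpose a b \<circ> p\<close> inserts the new point \<open>a\<close>
  directly before \<open>b\<close>: what \<open>p\<close> sent to \<open>b\<close> now goes to
  \<open>a\<close>, and \<open>a\<close>, fixed by \<open>p\<close>, goes to \<open>b\<close>.
  Deleting \<open>a\<close> gives back the cycle of \<open>p\<close>.\<close>

lemma orbit_transpose_comp:
  assumes p: "p permutes A" and a: "a \<notin> A" and b: "b \<in> A" and x: "x \<in> A"
  shows "orbit (transpose a b \<circ> p) x - {a} = orbit p x"
proof -
  define q where "q = transpose a b \<circ> p"
  have pa: "p a = a" using p a by (rule permutes_not_in)
  have an: "a \<notin> orbit p x" using permutes_orbit_subset[OF p x] a by auto
  have qa: "q a = b" using pa by (simp add: q_def)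
  have qb: "q y = a" if "p y = b" for y using that by (simp add: q_def)
  have q: "q y = p y" if "y \<in> A" "p y \<noteq> b" for y
  proof -
    have "p y \<noteq> a" using that(1) a permutes_in_image[OF p, of y] by auto
    then show ?thesis using that(2) by (simp add: q_def)
  qed
  \<comment> \<open>The only way from \<open>A\<close> into \<open>a\<close> starts at the
    \<open>p\<close>-preimage of \<open>b\<close>, so the invariant records that \<open>b\<close> is
    on the cycle of \<open>p\<close> once \<open>a\<close> is reached.\<close>
  have "y \<in> orbit p x \<or> (y = a \<and> b \<in> orbit p x)" if "y \<in> orbit q x" for y
    using that
  proof induction
    case base
    show ?case using q[OF x] qb[of x] orbit.base[of p x] by (cases "p x = b") auto
  next
    case (step y)
    show ?case
    proof (cases "y = a")
      case True
      then show ?thesis using step qa an by simp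
    next
      case False
      then have y: "y \<in> orbit p x" "y \<in> A"
        using step permutes_orbit_subset[OF p x] by auto
      show ?thesis using q[OF y(2)] qb[of y] orbit.step[OF y(1)] by (cases "p y = b") auto
    qed
  qed
  \<comment> \<open>A step of \<open>p\<close> into \<open>b\<close> is matched by two steps of
    \<open>q\<close>, through \<open>a\<close>.\<close>
  moreover have "y \<in> orbit q x" if "y \<in> orbit p x" for y
    using that
  proof induction
    case base
    show ?case
      using orbit.step[of a q x] qa qb[of x] q[OF x] orbit.base[of q x] by (cases "p x = b") auto
  next
    case (step y)
    then have "y \<in> A" using permutes_orbit_subset[OF p x] by auto
    then show ?case
      using orbit.step[of a q x] qa qb[of y] q[of y] orbit.step[OF step.IH] by (cases "p y = b") auto
  qed
  ultimately show ?thesis using an unfolding q_def by blast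
qed

text \<open>The point \<open>a\<close> joins the cycle of \<open>b\<close>, so it adds no orbit, and
  deleting it maps the orbits of the composite bijectively to those of \<open>p\<close>.\<close>

lemma card_orbits_transpose_comp:
  assumes p: "p permutes A" and fin: "finite A" and a: "a \<notin> A" and b: "b \<in> A"
  shows "card (orbit (transpose a b \<circ> p) ` insert a A) = card (orbit p ` A)"
proof -
  let ?q = "transpose a b \<circ> p"
  have q: "permutation ?q"
    using p fin by (intro permutation_compose permutation_swap_id) (auto simp: permutation_permutes)
  have "?q a = b" using permutes_not_in[OF p a] by simp
  then have "orbit ?q a = orbit ?q b" using permutation_orbit_step[OF q, of a] by simp
  then have "orbit ?q ` insert a A = orbit ?q ` A" using b by auto
  moreover have "orbit p ` A = (\<lambda>Q. Q - {a}) ` orbit ?q ` A"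
    unfolding image_image using orbit_transpose_comp[OF p a b] by auto
  moreover have "inj_on (\<lambda>Q. Q - {a}) (orbit ?q ` A)"
  proof (rule inj_onI, clarify)
    fix x y assume xy: "x \<in> A" "y \<in> A" "orbit ?q x - {a} = orbit ?q y - {a}"
    \<comment> \<open>The point \<open>x\<close> differs from \<open>a\<close>, so it survives the
      deletion and lies in both orbits; orbits with a common point coincide.\<close>
    then have "x \<in> orbit ?q y"
      using permutation_self_in_orbit[OF q, of x] a by blast
    then show "orbit ?q x = orbit ?q y"
      using cyclic_on_orbit'[OF q, of y] orbit_cyclic_eq3 by metis
  qed
  ultimately show ?thesis by (simp add: card_image)
qed

lemma card_orbits_insert_fixed:
  assumes p: "p permutes A" and fin: "finite A" and a: "a \<notin> A"
  shows "card (orbit p ` insert a A) = Suc (card (orbit p ` A))"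
proof -
  have "orbit p a = {a}" using permutes_not_in[OF p a] by (simp add: orbit_eq_singleton_iff)
  moreover have "{a} \<notin> orbit p ` A"
    using permutes_orbit_subset[OF p] a by fastforce
  ultimately show ?thesis using fin by simp
qed

text \<open>This is the recurrence of the Stirling numbers. Each permutation of
  \<open>insert a A\<close> is \<open>transpose a b \<circ> p\<close> for exactly one
  \<open>b\<close> in \<open>insert a A\<close> and one \<open>p\<close> permuting \<open>A\<close>.
  If \<open>b\<close> is in \<open>A\<close>, the number of orbits is that of \<open>p\<close>; if
  \<open>b = a\<close>, the permutation is \<open>p\<close> itself with the extra orbit
  \<open>{a}\<close>.\<close>

lemma card_permutes_orbits_insert:
  fixes A :: "'a set"
  assumes fin: "finite A" and a: "a \<notin> A"
  defines "N \<equiv> \<lambda>B k. card {p :: 'a \<Rightarrow> 'a. p permutes B \<and> card (orbit p ` B) = k}"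
  shows "N (insert a A) (Suc k) = card A * N A (Suc k) + N A k"
proof -
  let ?g = "\<lambda>(b, p). transpose a b \<circ> p"
  let ?P = "\<lambda>k. {p :: 'a \<Rightarrow> 'a. p permutes A \<and> card (orbit p ` A) = k}"
  have finP: "finite (?P k)" for k
    by (rule finite_subset[OF _ finite_permutations[OF fin]]) auto
  have "{p. p permutes insert a A \<and> card (orbit p ` insert a A) = Suc k}
      = {q \<in> ?g ` {(b, p). b \<in> insert a A \<and> p permutes A}. card (orbit q ` insert a A) = Suc k}"
    using permutes_insert[of a A] by auto
  also have "\<dots> = ?g ` (A \<times> ?P (Suc k) \<union> {a} \<times> ?P k)"
    using card_orbits_transpose_comp[OF _ fin a] card_orbits_insert_fixed[OF _ fin a] a
    by (auto simp: image_iff)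
  finally have "N (insert a A) (Suc k) = card (?g ` (A \<times> ?P (Suc k) \<union> {a} \<times> ?P k))"
    by (simp add: N_def)
  also have "inj_on ?g (A \<times> ?P (Suc k) \<union> {a} \<times> ?P k)"
  proof (rule inj_onI, clarify)
    fix b p c q
    assume *: "(b, p) \<in> A \<times> ?P (Suc k) \<union> {a} \<times> ?P k"
      "(c, q) \<in> A \<times> ?P (Suc k) \<union> {a} \<times> ?P k" "transpose a b \<circ> p = transpose a c \<circ> q"
    \<comment> \<open>Since \<open>p\<close> and \<open>q\<close> fix \<open>a\<close>, the
      composites send \<open>a\<close> to \<open>b\<close> and to \<open>c\<close>, which recovers
      the pair from its composite.\<close>
    then have "p a = a" "q a = a" using permutes_not_in[OF _ a] by auto
    then have bc: "b = c" using fun_cong[OF *(3), of a] by simp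
    have "p = transpose a b \<circ> (transpose a b \<circ> p)" by (simp add: fun_eq_iff)
    also have "\<dots> = q" using *(3) bc by (simp add: fun_eq_iff)
    finally show "b = c \<and> p = q" using bc by simp
  qed
  then have "card (?g ` (A \<times> ?P (Suc k) \<union> {a} \<times> ?P k)) = card (A \<times> ?P (Suc k) \<union> {a} \<times> ?P k)"
    by (rule card_image)
  also have "\<dots> = card A * N A (Suc k) + N A k"
    using a fin finP by (subst card_Un_disjoint) (auto simp: N_def card_cartesian_product)
  finally show ?thesis .
qed

text \<open>Both sides satisfy the same recurrence and boundary values. Passing to
  \<open>stirling\<close> gives access to its closed form for \<open>k = 2\<close>.\<close>

lemma stirling1_eq_stirling: "stirling1 m k = stirling m k"
proof (induction m arbitrary: k)
  case 0
  show ?case by (cases k) (auto simp: stirling1_def)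
next
  case (Suc m)
  have ins: "{1..Suc m} = insert (Suc m) {1..m}" by auto
  show ?case
  proof (cases k)
    case 0
    \<comment> \<open>Finiteness excludes the default value 0 of \<open>card\<close> on infinite
      sets, so a nonempty domain has at least one orbit.\<close>
    have "finite (orbit p ` {1..Suc m})" for p :: "nat \<Rightarrow> nat" by simp
    then show ?thesis using 0 by (auto simp: stirling1_def card_eq_0_iff)
  next
    case (Suc j)
    have "stirling1 (Suc m) (Suc j) = m * stirling1 m (Suc j) + stirling1 m j"
      using card_permutes_orbits_insert[of "{1..m}" "Suc m" j] unfolding stirling1_def ins by simp
    then show ?thesis using Suc Suc.IH by simp
  qed
qed

section \<open>The permutations and the restricted parking functions\<close>

text \<open>For a pattern of length three the selection map is a triple of increasing positions.
  Diagonal comparisons are false on both sides, which leaves the six ordered pairs.\<close>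

lemma contains_pattern_3:
  "contains_pattern n \<sigma> [x, y, z] \<longleftrightarrow>
    (\<exists>a b c. 1 \<le> a \<and> a < b \<and> b < c \<and> c \<le> n \<and>
      (\<sigma> a < \<sigma> b \<longleftrightarrow> x < y) \<and> (\<sigma> b < \<sigma> a \<longleftrightarrow> y < x) \<and>
      (\<sigma> a < \<sigma> c \<longleftrightarrow> x < z) \<and> (\<sigma> c < \<sigma> a \<longleftrightarrow> z < x) \<and>
      (\<sigma> b < \<sigma> c \<longleftrightarrow> y < z) \<and> (\<sigma> c < \<sigma> b \<longleftrightarrow> z < y))" (is "?L \<longleftrightarrow> ?R")
proof
  assume ?L
  then obtain f where f: "strict_mono_on {..<3} f" "f ` {..<3} \<subseteq> {1..n}"
    "\<And>a b. a < 3 \<Longrightarrow> b < 3 \<Longrightarrow> \<sigma> (f a) < \<sigma> (f b) \<longleftrightarrow> [x, y, z] ! a < [x, y, z] ! b"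
    unfolding contains_pattern_def by (auto simp: numeral_3_eq_3)
  have "f 0 < f 1" "f 1 < f 2"
    using f(1) by (auto simp: strict_mono_on_def)
  moreover have "1 \<le> f 0" "f 2 \<le> n"
    using f(2) by (simp_all add: image_subset_iff)
  ultimately show ?R
    using f(3)[of 0 1] f(3)[of 1 0] f(3)[of 0 2] f(3)[of 2 0] f(3)[of 1 2] f(3)[of 2 1]
    by (intro exI[of _ "f 0"] exI[of _ "f 1"] exI[of _ "f 2"]) simp
next
  assume ?R
  then obtain a b c where abc: "1 \<le> a" "a < b" "b < c" "c \<le> n"
      "\<sigma> a < \<sigma> b \<longleftrightarrow> x < y" "\<sigma> b < \<sigma> a \<longleftrightarrow> y < x"
      "\<sigma> a < \<sigma> c \<longleftrightarrow> x < z" "\<sigma> c < \<sigma> a \<longleftrightarrow> z < x"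
      "\<sigma> b < \<sigma> c \<longleftrightarrow> y < z" "\<sigma> c < \<sigma> b \<longleftrightarrow> z < y" by blast
  have 3: "i < 3 \<longleftrightarrow> i = 0 \<or> i = 1 \<or> i = 2" for i :: nat by auto
  have "strict_mono_on {..<3} (\<lambda>i. [a, b, c] ! i)"
    using abc(2,3) by (auto simp: strict_mono_on_def 3)
  moreover have "(\<lambda>i. [a, b, c] ! i) ` {..<3} \<subseteq> {1..n}"
    using abc(1-4) by (auto simp: 3)
  moreover have "\<forall>i<3. \<forall>j<3. \<sigma> ([a, b, c] ! i) < \<sigma> ([a, b, c] ! j) \<longleftrightarrow> [x, y, z] ! i < [x, y, z] ! j"
    using abc(5-) by (auto simp: 3)
  ultimately show ?L
    unfolding contains_pattern_def by (intro exI[of _ "\<lambda>i. [a, b, c] ! i"]) (simp add: numeral_3_eq_3)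
qed

text \<open>Whatever \<open>\<sigma>(n)\<close> is, an ascent before position \<open>n\<close> completes to one of the patterns 123, 132,
  231, and a descent to one of 213, 312, 321.\<close>

lemma mem_T_iff:
  assumes "b \<in> {1, 2}"
  shows "\<sigma> \<in> T b n \<longleftrightarrow> \<sigma> permutes {1..n} \<and>
    (\<forall>i j. 1 \<le> i \<longrightarrow> i < j \<longrightarrow> j < n \<longrightarrow> (if b = 1 then \<sigma> j < \<sigma> i else \<sigma> i < \<sigma> j))"
proof (cases "\<sigma> permutes {1..n}")
  case True
  have ne: "\<sigma> i \<noteq> \<sigma> j" if "i < j" for i j
    using injD[OF permutes_inj[OF True], of i j] that by auto
  have pat: "contains_pattern n \<sigma> [x, y, z]"
    if "1 \<le> i" "i < j" "j < n" "\<sigma> i < \<sigma> j \<longleftrightarrow> x < y" "\<sigma> j < \<sigma> i \<longleftrightarrow> y < x"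
      "\<sigma> i < \<sigma> n \<longleftrightarrow> x < z" "\<sigma> n < \<sigma> i \<longleftrightarrow> z < x"
      "\<sigma> j < \<sigma> n \<longleftrightarrow> y < z" "\<sigma> n < \<sigma> j \<longleftrightarrow> z < y" for x y z i j
    unfolding contains_pattern_3 using that by blast
  \<comment> \<open>The third position of an occurrence is at most \<open>n\<close>, so the first
    two lie below \<open>n\<close>, ordered like the first two letters of the pattern. These letters
    ascend in all patterns of the first family and descend in all of the second.\<close>
  have pair: "\<exists>i j. 1 \<le> i \<and> i < j \<and> j < n \<and> (\<sigma> i < \<sigma> j \<longleftrightarrow> x < y)"
    if "contains_pattern n \<sigma> [x, y, z]" for x y z
    using that unfolding contains_pattern_3 by (meson less_le_trans)
  have asc: "contains_pattern n \<sigma> [1,2,3] \<or> contains_pattern n \<sigma> [1,3,2] \<or> contains_pattern n \<sigma> [2,3,1]"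
    if ij: "1 \<le> i" "i < j" "j < n" "\<sigma> i < \<sigma> j" for i j
  proof -
    consider "\<sigma> j < \<sigma> n" | "\<sigma> i < \<sigma> n" "\<sigma> n < \<sigma> j" | "\<sigma> n < \<sigma> i"
      using ne[of i n] ne[of j n] ij by linarith
    then show ?thesis
    proof cases
      case 1 then show ?thesis using ij pat[of i j 1 2 3] by simp
    next
      case 2 then show ?thesis using ij pat[of i j 1 3 2] by simp
    next
      case 3 then show ?thesis using ij pat[of i j 2 3 1] by simp
    qed
  qed
  have desc: "contains_pattern n \<sigma> [2,1,3] \<or> contains_pattern n \<sigma> [3,1,2] \<or> contains_pattern n \<sigma> [3,2,1]"
    if ij: "1 \<le> i" "i < j" "j < n" "\<sigma> j < \<sigma> i" for i j
  proof -
    consider "\<sigma> i < \<sigma> n" | "\<sigma> j < \<sigma> n" "\<sigma> n < \<sigma> i" | "\<sigma> n < \<sigma> j"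
      using ne[of i n] ne[of j n] ij by linarith
    then show ?thesis
    proof cases
      case 1 then show ?thesis using ij pat[of i j 2 1 3] by simp
    next
      case 2 then show ?thesis using ij pat[of i j 3 1 2] by simp
    next
      case 3 then show ?thesis using ij pat[of i j 3 2 1] by simp
    qed
  qed
  show ?thesis
  proof (cases "b = 1")
    case b: True
    have "\<sigma> \<in> T b n \<longleftrightarrow> \<not> (contains_pattern n \<sigma> [1,2,3] \<or> contains_pattern n \<sigma> [1,3,2] \<or> contains_pattern n \<sigma> [2,3,1])"
      using b True by (simp add: T_def avoiding_def)
    also have "\<dots> \<longleftrightarrow> \<not> (\<exists>i j. 1 \<le> i \<and> i < j \<and> j < n \<and> \<sigma> i < \<sigma> j)"
      using asc pair[of 1 2 3] pair[of 1 3 2] pair[of 2 3 1] by auto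
    also have "\<dots> \<longleftrightarrow> (\<forall>i j. 1 \<le> i \<longrightarrow> i < j \<longrightarrow> j < n \<longrightarrow> \<sigma> j < \<sigma> i)"
      using ne by (meson linorder_neqE_nat less_asym)
    finally show ?thesis using b True by simp
  next
    case b: False
    have "\<sigma> \<in> T b n \<longleftrightarrow> \<not> (contains_pattern n \<sigma> [2,1,3] \<or> contains_pattern n \<sigma> [3,1,2] \<or> contains_pattern n \<sigma> [3,2,1])"
      using b True by (simp add: T_def avoiding_def)
    also have "\<dots> \<longleftrightarrow> \<not> (\<exists>i j. 1 \<le> i \<and> i < j \<and> j < n \<and> \<not> \<sigma> i < \<sigma> j)"
      using desc ne pair[of 2 1 3] pair[of 3 1 2] pair[of 3 2 1]
      by simp (meson linorder_neqE_nat)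
    finally show ?thesis using b True by auto
  qed
next
  case False
  then show ?thesis by (auto simp: T_def avoiding_def)
qed

text \<open>The first \<open>n - 1\<close> values run through \<open>{1..n}\<close> in increasing
  order and skip only \<open>f n\<close>, so the last value determines the whole map.\<close>

lemma strict_mono_permutation_eq:
  fixes f :: "nat \<Rightarrow> nat"
  assumes bij: "bij_betw f {1..n} {1..n}"
    and mono: "\<And>i j. 1 \<le> i \<Longrightarrow> i < j \<Longrightarrow> j < n \<Longrightarrow> f i < f j"
    and i: "1 \<le> i" "i < n"
  shows "f i = (if i < f n then i else Suc i)"
proof -
  have inj: "inj_on f {1..n}" and im: "f ` {1..n} = {1..n}"
    using bij by (auto simp: bij_betw_def)
  have ran: "f j \<in> {1..n}" if "1 \<le> j" "j \<le> n" for j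
    using that bij_betwE[OF bij] by auto
  have ne: "f j \<noteq> f n" if "1 \<le> j" "j < n" for j
    using that inj_on_eq_iff[OF inj, of j n] by auto
  have fi: "f i \<in> {1..n}" "f i \<noteq> f n" using ran[of i] ne[OF i] i by auto
  \<comment> \<open>By monotonicity the values below \<open>f i\<close>, apart from
    \<open>f n\<close>, are taken exactly at the positions before \<open>i\<close>. Comparing
    cardinalities gives \<open>f i = i\<close> if \<open>f i < f n\<close> and
    \<open>f i = Suc i\<close> otherwise.\<close>
  have "f ` {1..<i} = {1..<f i} - {f n}"
  proof (intro Set.set_eqI iffI)
    fix v assume "v \<in> f ` {1..<i}"
    then obtain j where j: "v = f j" "1 \<le> j" "j < i" by auto
    then show "v \<in> {1..<f i} - {f n}" using ran[of j] ne[of j] mono[of j i] i by auto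
  next
    fix v assume v: "v \<in> {1..<f i} - {f n}"
    then have "v \<in> {1..n}" using fi by auto
    then have "v \<in> f ` {1..n}" unfolding im .
    then obtain j where j: "v = f j" "1 \<le> j" "j \<le> n" by auto
    then have "j < n" using v by (cases "j = n") auto
    then have "j < i" using mono[of i j] v j i by (cases i j rule: linorder_cases) auto
    then show "v \<in> f ` {1..<i}" using j by auto
  qed
  moreover have "card (f ` {1..<i}) = i - 1"
    using i by (subst card_image[OF inj_on_subset[OF inj]]) auto
  ultimately have "i - 1 = card ({1..<f i} - {f n})" by simp
  moreover have "f n \<in> {1..n}" using ran[of n] i by auto
  ultimately show ?thesis using fi i by (cases "f n < f i") (auto simp: card_Diff_singleton_if)
qed

text \<open>The two families differ only by reversing the first \<open>n - 1\<close> positions; \<open>rev_index\<close> is this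
  reversal, meaningful at positions below \<open>n\<close>. For the unique \<open>\<sigma> \<in> T b n\<close> with
  \<open>n + 1 - \<sigma>(n) = k\<close>, the value \<open>n + 1 - \<sigma>(i)\<close> is \<open>codegree b n k i\<close>.\<close>

definition rev_index :: "nat \<Rightarrow> nat \<Rightarrow> nat \<Rightarrow> nat" where
  "rev_index b n i = (if b = 1 then i else n - i)"

definition codegree :: "nat \<Rightarrow> nat \<Rightarrow> nat \<Rightarrow> nat \<Rightarrow> nat" where
  "codegree b n k i =
    (if i = n then k else if rev_index b n i < k then rev_index b n i else Suc (rev_index b n i))"

lemma rev_index:
  assumes "i \<in> {1..<n}"
  shows "rev_index b n i \<in> {1..<n}" "rev_index b n (rev_index b n i) = i"
  using assms by (auto simp: rev_index_def)

lemma bij_betw_rev_index: "bij_betw (rev_index b n) {1..<n} {1..<n}"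
  by (rule bij_betw_byWitness[of _ "rev_index b n"]) (auto simp: rev_index_def)

text \<open>The rigidity of \<open>strict_mono_permutation_eq\<close> applies directly to
  \<open>\<sigma>\<close> when \<open>b = 2\<close>. When \<open>b = 1\<close>, where
  \<open>\<sigma>\<close> decreases, it applies to the complement
  \<open>n + 1 - \<sigma> i\<close>.\<close>

lemma T_codegree:
  assumes b: "b \<in> {1, 2}" and n: "n \<ge> 1" and \<sigma>: "\<sigma> \<in> T b n" and i: "i \<in> {1..n}"
  shows "n + 1 - \<sigma> i = codegree b n (n + 1 - \<sigma> n) i"
proof (cases "i = n")
  case False
  have perm: "\<sigma> permutes {1..n}" using \<sigma> mem_T_iff[OF b] by blast
  have n': "\<sigma> n \<in> {1..n}" "\<sigma> i \<in> {1..n}" using permutes_in_image[OF perm] n i by auto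
  show ?thesis
  proof (cases "b = 1")
    case True
    have "bij_betw ((\<lambda>v. n + 1 - v) \<circ> \<sigma>) {1..n} {1..n}"
      by (rule bij_betw_trans[OF permutes_imp_bij[OF perm]])
        (rule bij_betw_byWitness[of _ "\<lambda>v. n + 1 - v"], auto)
    moreover have "((\<lambda>v. n + 1 - v) \<circ> \<sigma>) i < ((\<lambda>v. n + 1 - v) \<circ> \<sigma>) j" if "1 \<le> i" "i < j" "j < n" for i j
    proof -
      have "\<sigma> j < \<sigma> i" using \<sigma> True that mem_T_iff[OF b, of \<sigma> n] by auto
      moreover have "\<sigma> i \<le> n" using permutes_in_image[OF perm, of i] that by auto
      ultimately show ?thesis by simp
    qed
    ultimately have "((\<lambda>v. n + 1 - v) \<circ> \<sigma>) i
        = (if i < ((\<lambda>v. n + 1 - v) \<circ> \<sigma>) n then i else Suc i)"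
      by (rule strict_mono_permutation_eq) (use i False in auto)
    then show ?thesis using False True by (simp add: codegree_def rev_index_def)
  next
    case b2: False
    have "\<sigma> i = (if i < \<sigma> n then i else Suc i)"
      by (rule strict_mono_permutation_eq[OF permutes_imp_bij[OF perm]])
        (use i False \<sigma> b2 mem_T_iff[OF b, of \<sigma> n] in auto)
    then show ?thesis using False b2 n' i by (auto simp: codegree_def rev_index_def split: if_splits)
  qed
qed (simp add: codegree_def)

text \<open>For each \<open>k\<close>, the codegrees take the value \<open>k\<close> at
  \<open>n\<close> and elsewhere skip \<open>k\<close>, so they run through \<open>{1..n}\<close>;
  complementing them yields the required permutation.\<close>

lemma ex_T_codegree:
  assumes b: "b \<in> {1, 2}" and k: "k \<in> {1..n}"
  shows "\<exists>\<sigma>\<in>T b n. \<forall>i\<in>{1..n}. n + 1 - \<sigma> i = codegree b n k i"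
proof -
  \<comment> \<open>Outside \<open>{1..n}\<close> the map is the identity, as
    \<open>permutes\<close> demands.\<close>
  define \<sigma> where "\<sigma> i = (if i \<in> {1..n} then n + 1 - codegree b n k i else i)" for i
  have c: "codegree b n k i \<in> {1..n}" if "i \<in> {1..n}" for i
    using that k by (auto simp: codegree_def rev_index_def)
  have "inj_on \<sigma> {1..n}"
  proof (rule inj_onI)
    fix i j assume ij: "i \<in> {1..n}" "j \<in> {1..n}" "\<sigma> i = \<sigma> j"
    then have "codegree b n k i = codegree b n k j" using c[OF ij(1)] c[OF ij(2)] by (auto simp: \<sigma>_def)
    then show "i = j" using ij by (auto simp: codegree_def rev_index_def split: if_splits)
  qed
  moreover have "\<sigma> ` {1..n} \<subseteq> {1..n}" using c by (fastforce simp: \<sigma>_def)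
  ultimately have "bij_betw \<sigma> {1..n} {1..n}"
    by (simp add: bij_betw_def endo_inj_surj)
  then have perm: "\<sigma> permutes {1..n}" by (rule bij_imp_permutes) (auto simp: \<sigma>_def)
  have "\<sigma> \<in> T b n"
    unfolding mem_T_iff[OF b] using perm b k
    by (auto simp: \<sigma>_def codegree_def rev_index_def)
  moreover have "n + 1 - \<sigma> i = codegree b n k i" if "i \<in> {1..n}" for i
    using that c[OF that] by (auto simp: \<sigma>_def)
  ultimately show ?thesis by blast
qed

text \<open>Each \<open>k\<close> gives a box \<open>p i < codegree b n k i\<close>. The last
  coordinate requires \<open>p n < k\<close>, while increasing \<open>k\<close> can only tighten the
  bounds at the other positions. Hence \<open>p\<close> lies in some box iff it lies in the one for
  \<open>k = Suc (p n)\<close>.\<close>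

lemma ex_T_le_iff:
  assumes b: "b \<in> {1, 2}" and n: "n \<ge> 1"
  shows "(\<exists>\<sigma>\<in>T b n. \<forall>i\<in>{1..n}. p i + \<sigma> i \<le> n) \<longleftrightarrow>
    p n < n \<and> (\<forall>i\<in>{1..<n}. p i \<le> rev_index b n i \<and> (rev_index b n i \<le> p n \<longrightarrow> p i < rev_index b n i))"
    (is "?L \<longleftrightarrow> ?R")
proof -
  \<comment> \<open>Truncation is harmless: for \<open>s > n\<close> both sides are false.\<close>
  have less: "p i + s \<le> n \<longleftrightarrow> p i < n + 1 - s" for i s by auto
  have "?L \<longleftrightarrow> (\<exists>k\<in>{1..n}. \<forall>i\<in>{1..n}. p i < codegree b n k i)"
  proof
    assume ?L
    then obtain \<sigma> where \<sigma>: "\<sigma> \<in> T b n" "\<forall>i\<in>{1..n}. p i < n + 1 - \<sigma> i" unfolding less by blast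
    then have "\<sigma> permutes {1..n}" using mem_T_iff[OF b] by blast
    then have "\<sigma> n \<in> {1..n}" using n permutes_in_image[of \<sigma> "{1..n}" n] by auto
    then have "n + 1 - \<sigma> n \<in> {1..n}" by auto
    moreover have "\<forall>i\<in>{1..n}. p i < codegree b n (n + 1 - \<sigma> n) i"
      using \<sigma>(2) T_codegree[OF b n \<sigma>(1)] by metis
    ultimately show "\<exists>k\<in>{1..n}. \<forall>i\<in>{1..n}. p i < codegree b n k i" by blast
  next
    assume "\<exists>k\<in>{1..n}. \<forall>i\<in>{1..n}. p i < codegree b n k i"
    then obtain k where k: "k \<in> {1..n}" "\<forall>i\<in>{1..n}. p i < codegree b n k i" by blast
    then show ?L unfolding less using ex_T_codegree[OF b k(1)] by metis
  qed
  also have "\<dots> \<longleftrightarrow> ?R"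
  proof
    assume "\<exists>k\<in>{1..n}. \<forall>i\<in>{1..n}. p i < codegree b n k i"
    then obtain k where k: "k \<in> {1..n}" "\<And>i. i \<in> {1..n} \<Longrightarrow> p i < codegree b n k i" by blast
    have "p n < k" using k(2)[of n] n by (simp add: codegree_def)
    moreover have "p i \<le> rev_index b n i \<and> (rev_index b n i \<le> p n \<longrightarrow> p i < rev_index b n i)" if "i \<in> {1..<n}" for i
      using k(2)[of i] that \<open>p n < k\<close> by (auto simp: codegree_def split: if_splits)
    ultimately show ?R using k(1) by auto
  next
    assume R: ?R
    \<comment> \<open>The least \<open>k\<close> above \<open>p n\<close> is the witness; then
      \<open>rev_index b n i < k\<close> means \<open>rev_index b n i \<le> p n\<close>.\<close>
    have "p i < codegree b n (Suc (p n)) i" if "i \<in> {1..n}" for i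
      using R[THEN conjunct2, rule_format, of i] that by (cases "i = n") (auto simp: codegree_def)
    then show "\<exists>k\<in>{1..n}. \<forall>i\<in>{1..n}. p i < codegree b n k i"
      using R by (intro bexI[of _ "Suc (p n)"]) auto
  qed
  finally show ?thesis .
qed

section \<open>Parking functions through counts of small entries\<close>

text \<open>In a sorted list the entries below \<open>v\<close> all precede a position whose entry
  is at least \<open>v\<close>. This converts a bound on one sorted entry into a count.\<close>

lemma length_filter_less_sorted:
  fixes xs :: "'a::linorder list"
  assumes "sorted xs" "v \<le> xs ! k"
  shows "length (filter (\<lambda>x. x < v) xs) \<le> k"
proof -
  have "{i. i < length xs \<and> xs ! i < v} \<subseteq> {..<k}"
  proof clarify
    fix i assume i: "i < length xs" "xs ! i < v"
    show "i < k"
    proof (rule ccontr)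
      assume "\<not> i < k"
      then have "xs ! k \<le> xs ! i" using i assms(1) by (intro sorted_nth_mono) auto
      then show False using i assms(2) by auto
    qed
  qed
  then have "card {i. i < length xs \<and> xs ! i < v} \<le> card {..<k}" by (intro card_mono) auto
  then show ?thesis by (simp add: length_filter_conv_card)
qed

text \<open>If at least \<open>j\<close> entries are below \<open>j\<close>, then so is the
  \<open>j\<close>-th smallest one. Sorting leaves the number of entries below \<open>j\<close>
  unchanged.\<close>

lemma PF_I:
  assumes "p \<in> {1..n} \<rightarrow>\<^sub>E UNIV" and "\<And>j. j \<in> {1..n} \<Longrightarrow> j \<le> card {i \<in> {1..n}. p i < j}"
  shows "p \<in> PF n"
proof -
  have "sort (map p [1..<Suc n]) ! (j - 1) < j" if j: "j \<in> {1..n}" for j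
  proof (rule ccontr)
    assume "\<not> ?thesis"
    then have "length (filter (\<lambda>x. x < j) (sort (map p [1..<Suc n]))) \<le> j - 1"
      by (intro length_filter_less_sorted) auto
    also have "length (filter (\<lambda>x. x < j) (sort (map p [1..<Suc n]))) = length (filter (\<lambda>i. p i < j) [1..<Suc n])"
      by (simp add: filter_sort filter_map o_def)
    also have "\<dots> = card {i \<in> {1..n}. p i < j}"
      by (subst distinct_card[symmetric]) (auto intro!: arg_cong[where f = card])
    finally show False using assms(2)[OF j] j by auto
  qed
  then show ?thesis using assms(1) by (simp add: PF_def)
qed

text \<open>Every entry is at most the last entry of the sorted list, which is below
  \<open>n\<close>.\<close>

lemma PF_less:
  assumes "p \<in> PF n" "i \<in> {1..n}"
  shows "p i < n"
proof -
  let ?xs = "sort (map p [1..<Suc n])"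
  have "p i \<in> set ?xs" using assms(2) by (auto simp del: upt_Suc)
  then obtain k where k: "k < length ?xs" "?xs ! k = p i" by (metis in_set_conv_nth)
  then have "p i \<le> ?xs ! (n - 1)" using sorted_nth_mono[of ?xs k "n - 1"] by auto
  also have "\<dots> < n" using assms by (auto simp: PF_def)
  finally show ?thesis .
qed

text \<open>For each \<open>j\<close>, at least \<open>j\<close> positions with entry below
  \<open>j\<close> are exhibited. The position \<open>rev_index b n t\<close> carries an entry at
  most \<open>t\<close>, and one below \<open>t\<close> whenever \<open>t \<le> p n\<close>.\<close>

lemma PF_if_below_rev_index:
  assumes p: "p \<in> {1..n} \<rightarrow>\<^sub>E UNIV" and pn: "p n < n"
    and le: "\<forall>i\<in>{1..<n}. p i \<le> rev_index b n i \<and> (rev_index b n i \<le> p n \<longrightarrow> p i < rev_index b n i)"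
  shows "p \<in> PF n"
proof (rule PF_I[OF p])
  fix j assume j: "j \<in> {1..n}"
  let ?r = "rev_index b n"
  have inj: "inj_on ?r {1..<n}" using bij_betw_rev_index by (auto simp: bij_betw_def)
  have r: "p (?r t) \<le> t" "t \<le> p n \<Longrightarrow> p (?r t) < t" "?r t \<in> {1..<n}" if "t \<in> {1..<n}" for t
    using le rev_index[OF that, of b] by metis+
  show "j \<le> card {i \<in> {1..n}. p i < j}"
  proof (cases "j \<le> p n")
    case True
    \<comment> \<open>For \<open>j \<le> p n\<close> the bounds at all \<open>t \<le> j\<close> are
      strict, so these \<open>j\<close> positions suffice without position \<open>n\<close>.\<close>
    have "?r ` {1..j} \<subseteq> {i \<in> {1..n}. p i < j}"
    proof clarify
      fix t assume "t \<in> {1..j}"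
      then have t: "t \<in> {1..<n}" "t \<le> p n" "t \<le> j" using True pn by auto
      from r(2,3)[OF t(1)] t show "?r t \<in> {1..n} \<and> p (?r t) < j" by auto
    qed
    then have "card (?r ` {1..j}) \<le> card {i \<in> {1..n}. p i < j}" by (intro card_mono) auto
    moreover have "card (?r ` {1..j}) = j"
      using True pn by (subst card_image[OF inj_on_subset[OF inj]]) auto
    ultimately show ?thesis by simp
  next
    case False
    \<comment> \<open>Now \<open>p n < j\<close>, so position \<open>n\<close> itself counts and
      supplements the \<open>j - 1\<close> positions with \<open>t < j\<close>.\<close>
    have "insert n (?r ` {1..<j}) \<subseteq> {i \<in> {1..n}. p i < j}"
    proof -
      have "?r t \<in> {1..n} \<and> p (?r t) < j" if "t \<in> {1..<j}" for t
      proof -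
        have t: "t \<in> {1..<n}" using that j by auto
        from r(1,3)[OF t] that show ?thesis by auto
      qed
      then show ?thesis using False j by auto
    qed
    then have "card (insert n (?r ` {1..<j})) \<le> card {i \<in> {1..n}. p i < j}" by (intro card_mono) auto
    moreover have "n \<notin> ?r ` {1..<j}"
    proof
      assume "n \<in> ?r ` {1..<j}"
      then obtain t where "t \<in> {1..<j}" and t: "?r t = n" by force
      then have "t \<in> {1..<n}" using j by auto
      then have "?r t \<in> {1..<n}" by (rule r(3))
      then show False using t by simp
    qed
    moreover have "card (?r ` {1..<j}) = j - 1"
      using j by (subst card_image[OF inj_on_subset[OF inj]]) auto
    ultimately show ?thesis by simp
  qed
qed

text \<open>Given the remaining inequalities, the parking condition amounts to
  \<open>p n < n\<close>. Both families then have the same description up to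
  \<open>rev_index\<close>.\<close>

lemma PF_hat_iff:
  assumes b: "b \<in> {1, 2}" and n: "n \<ge> 1"
  shows "p \<in> PF_hat b n \<longleftrightarrow> p \<in> {1..n} \<rightarrow>\<^sub>E UNIV \<and> p n < n \<and>
    (\<forall>i\<in>{1..<n}. p i \<le> rev_index b n i \<and> (rev_index b n i \<le> p n \<longrightarrow> p i < rev_index b n i))"
    (is "_ \<longleftrightarrow> ?P \<and> ?Q \<and> ?R")
proof -
  have split: "{1..n} = insert n {1..<n}" using n by auto
  have PF: "p \<in> PF n \<and> ?R \<longleftrightarrow> ?P \<and> ?Q \<and> ?R"
    using PF_if_below_rev_index[of p n b] PF_less[of p n n] n by (auto simp: PF_def)
  have "p \<in> PF_hat b n \<longleftrightarrow> p \<in> PF n \<and> ?R"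
  proof (cases "b = 1")
    case True
    \<comment> \<open>Given \<open>p t \<le> t\<close>, the two implications are contrapositives of
      each other.\<close>
    have *: "p t \<le> t \<and> (p t = t \<longrightarrow> p n < t) \<longleftrightarrow> p t \<le> t \<and> (t \<le> p n \<longrightarrow> p t < t)" for t by auto
    have "p \<in> PF_hat b n \<longleftrightarrow> p \<in> PF n \<and> (\<forall>t\<in>{1..n}. p t \<le> t \<and> (p t = t \<longrightarrow> p n < t))"
      using True by (auto simp: PF_hat_def)
    also have "\<dots> \<longleftrightarrow> p \<in> PF n \<and> ?R"
      \<comment> \<open>At \<open>t = n\<close> the conditions of the first family follow from
        \<open>p n < n\<close>; the others are those of \<open>?R\<close>.\<close>
      unfolding * split using True PF_less[of p n n] n by (auto simp: rev_index_def)
    finally show ?thesis .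
  next
    case False
    have *: "p (n - t) \<le> t \<and> (p (n - t) = t \<longrightarrow> p n < t) \<longleftrightarrow>
      p (n - t) \<le> t \<and> (t \<le> p n \<longrightarrow> p (n - t) < t)" for t by auto
    have im: "{1..<n} = (\<lambda>t. n - t) ` {1..<n}"
      using bij_betw_rev_index[of 2 n] by (simp add: bij_betw_def rev_index_def cong: image_cong)
    have "p \<in> PF_hat b n \<longleftrightarrow> p \<in> PF n \<and> (\<forall>t\<in>{1..<n}. p (n - t) \<le> t \<and> (p (n - t) = t \<longrightarrow> p n < t))"
      using False by (auto simp: PF_hat_def)
    also have "\<dots> \<longleftrightarrow> p \<in> PF n \<and> ?R"
      unfolding * by (subst (2) im) (use False in \<open>auto simp: rev_index_def\<close>)
    finally show ?thesis .
  qed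
  then show ?thesis using PF by blast
qed

text \<open>The restricted parking functions and the exponents of the standard monomials are cut out
  by the same inequalities, which links the combinatorial and the algebraic side.\<close>

lemma PF_hat_eq_T:
  assumes "b \<in> {1, 2}" "n \<ge> 1"
  shows "PF_hat b n = {p \<in> {1..n} \<rightarrow>\<^sub>E UNIV. \<exists>\<sigma>\<in>T b n. \<forall>i\<in>{1..n}. p i + \<sigma> i \<le> n}"
  unfolding ex_T_le_iff[OF assms] by (rule Set.set_eqI) (simp add: PF_hat_iff[OF assms])

section \<open>Counting by the last entry\<close>

text \<open>The factors of the product are \<open>1, ..., m\<close> and
  \<open>m + 2, ..., n\<close>, so only \<open>m + 1\<close> is missing from the factorial.\<close>

lemma prod_skip_factor:
  fixes m n :: nat
  assumes "m < n"
  shows "Suc m * (\<Prod>t\<in>{1..<n}. if t \<le> m then t else Suc t) = fact n"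
  using Suc_leI[OF assms]
proof (induction n rule: dec_induct)
  case base
  have "(\<Prod>t\<in>{1..<Suc m}. if t \<le> m then t else Suc t) = \<Prod>{1..m}"
    by (rule prod.cong) auto
  then show ?case by (simp add: fact_prod)
next
  case (step n)
  then show ?case by (simp add: prod.atLeastLessThan_Suc algebra_simps)
qed

lemma card_PF_hat:
  assumes b: "b \<in> {1, 2}" and n: "n \<ge> 1"
  shows "card (PF_hat b n) = stirling (n + 1) 2"
proof -
  let ?r = "rev_index b n"
  \<comment> \<open>Once \<open>p n = m\<close> is fixed, \<open>B m i\<close> is the set of values
    allowed at position \<open>i\<close>, independently of the other positions.\<close>
  define B where "B m i = (if i = n then {m} else if ?r i \<le> m then {..<?r i} else {..?r i})" for m i
  have split: "{1..n} = insert n {1..<n}" using n by auto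
  have "PF_hat b n = (\<Union>m\<in>{..<n}. Pi\<^sub>E {1..n} (B m))"
  proof (rule Set.set_eqI)
    fix p
    have B: "p n \<in> B m n \<longleftrightarrow> p n = m"
      "i \<in> {1..<n} \<Longrightarrow> p i \<in> B m i \<longleftrightarrow> p i \<le> ?r i \<and> (?r i \<le> m \<longrightarrow> p i < ?r i)" for m i
      by (auto simp: B_def)
    have "p \<in> Pi\<^sub>E {1..n} (B m) \<longleftrightarrow> p \<in> {1..n} \<rightarrow>\<^sub>E UNIV \<and> p n \<in> B m n \<and> (\<forall>i\<in>{1..<n}. p i \<in> B m i)" for m
      unfolding PiE_iff split by blast
    then have "p \<in> Pi\<^sub>E {1..n} (B m) \<longleftrightarrow> p \<in> {1..n} \<rightarrow>\<^sub>E UNIV \<and> p n = m \<and>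
      (\<forall>i\<in>{1..<n}. p i \<le> ?r i \<and> (?r i \<le> p n \<longrightarrow> p i < ?r i))" for m
      using B by auto
    then show "p \<in> PF_hat b n \<longleftrightarrow> p \<in> (\<Union>m\<in>{..<n}. Pi\<^sub>E {1..n} (B m))"
      using PF_hat_iff[OF b n, of p] by auto
  qed
  also have "card \<dots> = (\<Sum>m<n. card (Pi\<^sub>E {1..n} (B m)))"
  proof (rule card_UN_disjoint)
    show "\<forall>m\<in>{..<n}. finite (Pi\<^sub>E {1..n} (B m))"
      by (auto intro!: finite_PiE simp: B_def)
    show "\<forall>m\<in>{..<n}. \<forall>m'\<in>{..<n}. m \<noteq> m' \<longrightarrow> Pi\<^sub>E {1..n} (B m) \<inter> Pi\<^sub>E {1..n} (B m') = {}"
    proof (intro ballI impI, rule ccontr)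
      fix m m' :: nat assume "m \<noteq> m'" "Pi\<^sub>E {1..n} (B m) \<inter> Pi\<^sub>E {1..n} (B m') \<noteq> {}"
      then obtain p where "p \<in> Pi\<^sub>E {1..n} (B m)" "p \<in> Pi\<^sub>E {1..n} (B m')" by blast
      then have "p n \<in> B m n" "p n \<in> B m' n" using n by (auto simp: PiE_iff)
      then show False using \<open>m \<noteq> m'\<close> by (simp add: B_def)
    qed
  qed simp
  also have "\<dots> = (\<Sum>m<n. fact n div Suc m)"
  proof (rule sum.cong)
    fix m assume m: "m \<in> {..<n}"
    have "card (Pi\<^sub>E {1..n} (B m)) = (\<Prod>i\<in>{1..<n}. card (B m i))"
      unfolding split by (subst card_PiE) (auto simp: B_def)
    also have "\<dots> = (\<Prod>i\<in>{1..<n}. if ?r i \<le> m then ?r i else Suc (?r i))"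
      by (rule prod.cong) (auto simp: B_def)
    \<comment> \<open>Reindexing by \<open>rev_index\<close> makes the product the same for both
      families.\<close>
    also have "\<dots> = (\<Prod>t\<in>{1..<n}. if t \<le> m then t else Suc t)"
      by (rule prod.reindex_bij_betw[OF bij_betw_rev_index])
    finally show "card (Pi\<^sub>E {1..n} (B m)) = fact n div Suc m"
      using prod_skip_factor[of m n] m by (metis lessThan_iff nonzero_mult_div_cancel_left nat.distinct(1))
  qed simp
  also have "\<dots> = (\<Sum>k=1..n. fact n div k)"
    by (rule sum.reindex_bij_witness[of _ "\<lambda>k. k - 1" Suc]) auto
  \<comment> \<open>The sum is the harmonic formula for the Stirling numbers with two
    cycles.\<close>
  also have "\<dots> = stirling (Suc n) 2" using stirling_Suc_n_2[of n] n by simp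
  finally show ?thesis by simp
qed

section \<open>Standard monomials of the Alexander dual\<close>

lemma var_power: "var i ^ k = Poly_Mapping.single (Poly_Mapping.single i k) 1"
  by (induction k) (simp_all add: var_def mult_single flip: single_add)

lemma prod_monomials:
  "(\<Prod>i\<in>A. Poly_Mapping.single (e i) (1 :: 'k::comm_semiring_1)) =
    Poly_Mapping.single (\<Sum>i\<in>A. e i) 1"
  by (induction A rule: infinite_finite_induct) (simp_all add: mult_single)

lemma sum_monomials_eq:
  fixes p :: "'a \<Rightarrow>\<^sub>0 'b::comm_monoid_add"
  shows "(\<Sum>m\<in>Poly_Mapping.keys p. Poly_Mapping.single m (Poly_Mapping.lookup p m)) = p"
  by (rule poly_mapping_eqI)
    (simp add: lookup_sum lookup_single when_def sum.delta' in_keys_iff)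

lemma a_inv_poly_ring:
  fixes p :: "'k::field mpoly"
  assumes "p \<in> carrier (poly_ring n)"
  shows "\<ominus>\<^bsub>poly_ring n\<^esub> p = - p"
proof -
  interpret cring "poly_ring n :: 'k mpoly ring" by (rule cring_poly_ring)
  show ?thesis
    by (rule minus_equality) (use assms in \<open>simp_all add: poly_ring_simps poly_ring_closed\<close>)
qed

text \<open>Every exponent of a product is a sum of exponents of the factors, so an upward closed
  \<open>U\<close> absorbs multiplication. Exponents in \<open>U\<close> that involve other
  variables are excluded by the carrier.\<close>

lemma ideal_keys_subset:
  assumes up: "\<And>m d. m \<in> U \<Longrightarrow> m + d \<in> U"
  shows "ideal {p \<in> carrier (poly_ring n :: 'k::field mpoly ring). Poly_Mapping.keys p \<subseteq> U}
    (poly_ring n)" (is "ideal ?I ?R")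
proof -
  interpret cring ?R by (rule cring_poly_ring)
  have mult: "Poly_Mapping.keys (a * x) \<subseteq> U" if "Poly_Mapping.keys a \<subseteq> U" for a x :: "'k mpoly"
    using keys_mult[of a x] that up by blast
  show ?thesis
  proof (rule idealI[OF ring_axioms])
    show "subgroup ?I (add_monoid ?R)"
    proof (rule add.subgroupI)
      show "?I \<noteq> {}" using zero_closed by (auto simp: poly_ring_simps)
      show "\<ominus>\<^bsub>?R\<^esub> p \<in> ?I" if "p \<in> ?I" for p
        using that poly_ring_closed(3)[of p n p] by (simp add: a_inv_poly_ring)
      show "p \<oplus>\<^bsub>?R\<^esub> q \<in> ?I" if "p \<in> ?I" "q \<in> ?I" for p q
        using that Poly_Mapping.keys_add[of p q] by (auto simp: poly_ring_simps poly_ring_closed)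
    qed auto
    fix a x assume "a \<in> ?I" "x \<in> carrier ?R"
    then show "x \<otimes>\<^bsub>?R\<^esub> a \<in> ?I" "a \<otimes>\<^bsub>?R\<^esub> x \<in> ?I"
      using mult[of a x] by (auto simp: poly_ring_simps poly_ring_closed mult.commute)
  qed
qed

text \<open>Membership in a monomial ideal is tested term by term. The right-hand side is an ideal
  containing the generators; conversely, each term of its elements is a multiple of a
  generator.\<close>

lemma genideal_monomials:
  assumes E: "\<And>e. e \<in> E \<Longrightarrow> Poly_Mapping.keys e \<subseteq> {1..n}"
  shows "Idl\<^bsub>poly_ring n\<^esub> ((\<lambda>e. Poly_Mapping.single e (1 :: 'k::field)) ` E) =
    {p \<in> carrier (poly_ring n). Poly_Mapping.keys p \<subseteq>
      {m. \<exists>e\<in>E. \<forall>i. Poly_Mapping.lookup e i \<le> Poly_Mapping.lookup m i}}"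
    (is "Idl\<^bsub>?R\<^esub> ?G = {p \<in> carrier ?R. Poly_Mapping.keys p \<subseteq> ?U}")
proof -
  interpret cring ?R by (rule cring_poly_ring)
  have G: "?G \<subseteq> carrier ?R" using E by (auto simp: carrier_poly_ring_iff)
  have I: "ideal {p \<in> carrier ?R. Poly_Mapping.keys p \<subseteq> ?U} ?R"
    by (rule ideal_keys_subset) (auto simp: lookup_add intro: trans_le_add1)
  interpret J: ideal "Idl\<^bsub>?R\<^esub> ?G" ?R by (rule genideal_ideal[OF G])
  show ?thesis
  proof
    show "Idl\<^bsub>?R\<^esub> ?G \<subseteq> {p \<in> carrier ?R. Poly_Mapping.keys p \<subseteq> ?U}"
      by (rule genideal_minimal[OF I]) (use G in auto)
    show "{p \<in> carrier ?R. Poly_Mapping.keys p \<subseteq> ?U} \<subseteq> Idl\<^bsub>?R\<^esub> ?G"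
    proof clarify
      fix p :: "'k mpoly" assume p: "p \<in> carrier ?R" "Poly_Mapping.keys p \<subseteq> ?U"
      have monom: "Poly_Mapping.single m c \<in> Idl\<^bsub>?R\<^esub> ?G" if m: "m \<in> Poly_Mapping.keys p" for m c
      proof -
        obtain e where e: "e \<in> E" "\<forall>i. Poly_Mapping.lookup e i \<le> Poly_Mapping.lookup m i"
          using m p(2) by auto
        \<comment> \<open>The pointwise subtraction is exact because \<open>e\<close> is below
          \<open>m\<close> in every coordinate.\<close>
        have "m = (m - e) + e"
          by (rule poly_mapping_eqI) (use e(2) in \<open>simp add: lookup_add lookup_minus\<close>)
        then have "Poly_Mapping.single m c = Poly_Mapping.single (m - e) c \<otimes>\<^bsub>?R\<^esub> Poly_Mapping.single e 1"
          by (simp add: poly_ring_simps mult_single)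
        moreover have "Poly_Mapping.single (m - e) c \<in> carrier ?R"
        proof -
          have "Poly_Mapping.keys (m - e) \<subseteq> Poly_Mapping.keys m"
            by (auto simp: in_keys_iff lookup_minus)
          then show ?thesis using p(1) m by (auto simp: carrier_poly_ring_iff)
        qed
        moreover have "Poly_Mapping.single e 1 \<in> Idl\<^bsub>?R\<^esub> ?G"
          using genideal_self[OF G] e(1) by auto
        ultimately show ?thesis by (simp add: J.I_l_closed)
      qed
      have "(\<Sum>m\<in>A. Poly_Mapping.single m (Poly_Mapping.lookup p m)) \<in> Idl\<^bsub>?R\<^esub> ?G"
        if "finite A" "A \<subseteq> Poly_Mapping.keys p" for A
        using that
      proof (induction A rule: finite_induct)
        case empty
        show ?case using J.zero_closed by (simp add: poly_ring_simps)
      next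
        case (insert m A)
        then show ?case
          using J.a_closed[OF monom[of m "Poly_Mapping.lookup p m"]] by (simp add: poly_ring_simps)
      qed
      from this[of "Poly_Mapping.keys p"] show "p \<in> Idl\<^bsub>?R\<^esub> ?G"
        by (simp add: sum_monomials_eq)
    qed
  qed
qed

section \<open>Dimension of a quotient by a monomial ideal\<close>

text \<open>The image of this copy of the field under the quotient map is the scalar field
  \<open>quot_scalars\<close>.\<close>

lemma subfield_constants: "subfield (range (Poly_Mapping.single 0)) (poly_ring n :: 'k::field mpoly ring)"
  (is "subfield ?K ?R")
proof -
  interpret cring ?R by (rule cring_poly_ring)
  have K: "?K \<subseteq> carrier ?R" by (auto simp: carrier_poly_ring_iff)
  have "subring ?K ?R"
  proof (rule subringI[OF K])
    show "\<one>\<^bsub>?R\<^esub> \<in> ?K" by (metis poly_ring_simps(3) rangeI single_one)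
    fix p q assume "p \<in> ?K"
    then obtain c where c: "p = Poly_Mapping.single 0 c" by blast
    show "\<ominus>\<^bsub>?R\<^esub> p \<in> ?K"
      using K \<open>p \<in> ?K\<close> by (subst a_inv_poly_ring) (auto simp: c simp flip: single_uminus)
    assume "q \<in> ?K"
    then obtain d where d: "q = Poly_Mapping.single 0 d" by blast
    show "p \<otimes>\<^bsub>?R\<^esub> q \<in> ?K" "p \<oplus>\<^bsub>?R\<^esub> q \<in> ?K"
      by (auto simp: c d poly_ring_simps mult_single simp flip: single_add)
  qed
  then have "subcring ?K ?R" using K by (intro subcringI) (auto intro: m_comm)
  then show ?thesis
  proof (rule subfieldI)
    have unit: "\<exists>q\<in>?K. q * Poly_Mapping.single 0 c = 1 \<and> Poly_Mapping.single 0 c * q = 1"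
      if "c \<noteq> 0" for c :: 'k
      using that by (intro bexI[of _ "Poly_Mapping.single 0 (inverse c)"]) (auto simp: mult_single)
    show "Units (?R\<lparr>carrier := ?K\<rparr>) = ?K - {\<zero>\<^bsub>?R\<^esub>}"
    proof
      show "Units (?R\<lparr>carrier := ?K\<rparr>) \<subseteq> ?K - {\<zero>\<^bsub>?R\<^esub>}"
        by (auto simp: Units_def poly_ring_simps)
      show "?K - {\<zero>\<^bsub>?R\<^esub>} \<subseteq> Units (?R\<lparr>carrier := ?K\<rparr>)"
      proof
        fix p assume "p \<in> ?K - {\<zero>\<^bsub>?R\<^esub>}"
        then obtain c where p: "p = Poly_Mapping.single 0 c" and "p \<noteq> 0" by (auto simp: poly_ring_simps)
        then have "c \<noteq> 0" by auto
        then show "p \<in> Units (?R\<lparr>carrier := ?K\<rparr>)"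
          using unit[of c] p by (simp add: Units_def poly_ring_simps)
      qed
    qed
  qed
qed

text \<open>The classes of the monomials with exponent in \<open>M\<close> form a basis. As
  \<open>dimension\<close> is defined inductively by line extensions, the span is built up one
  monomial at a time. The hypothesis \<open>0 \<in> M\<close> keeps 1 out of the ideal, so that the
  scalars form a field.\<close>

lemma dimension_quotient_keys_subset:
  fixes U :: "(nat \<Rightarrow>\<^sub>0 nat) set" and R :: "'k::field mpoly ring" and n :: nat
  defines "R \<equiv> poly_ring n"
  defines "I \<equiv> {p \<in> carrier R. Poly_Mapping.keys p \<subseteq> U}"
  defines "M \<equiv> {m. Poly_Mapping.keys m \<subseteq> {1..n}} - U"
  assumes up: "\<And>m d. m \<in> U \<Longrightarrow> m + d \<in> U" and fin: "finite M" and M0: "0 \<in> M"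
  shows "ring (R Quot I)" and "subfield (quot_scalars n I) (R Quot I)"
    and "ring.dimension (R Quot I) (card M) (quot_scalars n I) (carrier (R Quot I))"
proof -
  interpret R: cring R unfolding R_def by (rule cring_poly_ring)
  interpret I: ideal I R unfolding I_def R_def using up by (rule ideal_keys_subset)
  show "ring (R Quot I)" by (rule I.quotient_is_ring)
  define h where "h = (+>\<^bsub>R\<^esub>) I"
  interpret h: ring_hom_ring R "R Quot I" h unfolding h_def by (rule I.rcos_ring_hom_ring)
  define K where "K = quot_scalars n I"
  have K: "K = h ` range (Poly_Mapping.single 0)"
    unfolding K_def quot_scalars_def h_def R_def by (simp add: image_image)
  have car: "p \<in> carrier R \<longleftrightarrow> (\<forall>m\<in>Poly_Mapping.keys p. Poly_Mapping.keys m \<subseteq> {1..n})" for p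
    by (simp add: R_def carrier_poly_ring_iff)
  have carM: "p \<in> carrier R" if "Poly_Mapping.keys p \<subseteq> M" for p
    using that by (auto simp: car M_def)
  \<comment> \<open>This is linear independence: congruent polynomials differ by an element
    supported on \<open>U\<close>, so their coefficients on \<open>M\<close> agree.\<close>
  have h_eqD: "Poly_Mapping.lookup p m = Poly_Mapping.lookup q m"
    if pq: "p \<in> carrier R" "q \<in> carrier R" "h p = h q" and m: "m \<in> M" for p q m
  proof -
    have "q \<in> I +>\<^bsub>R\<^esub> p"
      using I.a_repr_independenceD[OF pq(2)] pq(3) by (simp add: h_def)
    then have "\<exists>i\<in>I. q = i \<oplus>\<^bsub>R\<^esub> p" unfolding a_r_coset_def' by blast
    then obtain i where i: "i \<in> I" "q = i + p" unfolding R_def poly_ring_simps by blast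
    then have "Poly_Mapping.keys i \<subseteq> U" unfolding I_def by blast
    moreover have "m \<notin> U" using m by (simp add: M_def)
    ultimately have "Poly_Mapping.lookup i m = 0" unfolding not_in_keys_iff_lookup_eq_zero[symmetric] by blast
    then show ?thesis using i(2) by (simp add: lookup_add)
  qed
  have h_surj: "carrier (R Quot I) = h ` carrier R"
    by (auto simp: FactRing_def A_RCOSETS_def' h_def)
  have h_I: "h p = h 0" if "p \<in> I" for p
    using that I.a_rcos_const[OF that] I.a_rcos_const[OF I.zero_closed]
    by (simp add: h_def R_def poly_ring_simps)
  have "\<one>\<^bsub>R Quot I\<^esub> \<noteq> \<zero>\<^bsub>R Quot I\<^esub>"
  proof
    assume "\<one>\<^bsub>R Quot I\<^esub> = \<zero>\<^bsub>R Quot I\<^esub>"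
    then have "h 1 = h 0" using h.hom_one h.hom_zero by (simp add: R_def poly_ring_simps)
    then show False using h_eqD[of 1 0 0] M0 by (auto simp: car)
  qed
  then show "subfield (quot_scalars n I) (R Quot I)"
    using h.img_is_subfield(2)[of "range (Poly_Mapping.single 0)"] subfield_constants[of n, where ?'k = 'k]
    unfolding K K_def[symmetric] R_def by blast
  have dim: "h.S.dimension (card A) K (h ` {p. Poly_Mapping.keys p \<subseteq> A})" if "finite A" "A \<subseteq> M" for A
    using that
  proof (induction A rule: finite_induct)
    case empty
    have "h ` {p. Poly_Mapping.keys p \<subseteq> {}} = {\<zero>\<^bsub>R Quot I\<^esub>}"
      using h.hom_zero by (simp add: R_def poly_ring_simps)
    then show ?case by simp
  next
    case (insert a A)
    define E where "E = h ` {p. Poly_Mapping.keys p \<subseteq> A}"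
    define v where "v = h (Poly_Mapping.single a 1)"
    have xa: "Poly_Mapping.single a c \<in> carrier R" for c
      using insert.prems by (intro carM) auto
    have v: "v \<in> carrier (R Quot I)" using xa unfolding v_def by (rule h.hom_closed)
    have comb: "h (Poly_Mapping.single 0 c) \<otimes>\<^bsub>R Quot I\<^esub> v \<oplus>\<^bsub>R Quot I\<^esub> h q = h (Poly_Mapping.single a c + q)"
      if "Poly_Mapping.keys q \<subseteq> A" for c q
    proof -
      have c: "Poly_Mapping.single 0 c \<in> carrier R" by (auto simp: car)
      have q: "q \<in> carrier R" using that insert.prems by (intro carM) auto
      have "Poly_Mapping.single a c = Poly_Mapping.single 0 c \<otimes>\<^bsub>R\<^esub> Poly_Mapping.single a 1"
        by (simp add: R_def poly_ring_simps mult_single)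
      moreover have "Poly_Mapping.single a c + q = Poly_Mapping.single a c \<oplus>\<^bsub>R\<^esub> q"
        by (simp add: R_def poly_ring_simps)
      ultimately show ?thesis using c q xa by (simp add: v_def)
    qed
    \<comment> \<open>In a representative supported on \<open>A\<close> the coefficient at
      \<open>a\<close> is 0, whereas in the new monomial it is 1.\<close>
    have "v \<notin> E"
    proof
      assume "v \<in> E"
      then obtain q where q: "Poly_Mapping.keys q \<subseteq> A" "v = h q" by (auto simp: E_def)
      then have "Poly_Mapping.lookup q a = 1"
        using h_eqD[of "Poly_Mapping.single a 1" q a] xa carM[of q] insert.prems by (auto simp: v_def)
      then have "a \<in> Poly_Mapping.keys q" by (simp add: in_keys_iff)
      then show False using q(1) insert.hyps by blast
    qed
    moreover have "h.S.line_extension K v E = h ` {p. Poly_Mapping.keys p \<subseteq> insert a A}"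
    proof (intro Set.set_eqI iffI)
      fix u assume "u \<in> h.S.line_extension K v E"
      then obtain c q where q: "Poly_Mapping.keys q \<subseteq> A"
        and "u = h (Poly_Mapping.single 0 c) \<otimes>\<^bsub>R Quot I\<^esub> v \<oplus>\<^bsub>R Quot I\<^esub> h q"
        unfolding h.S.line_extension_mem_iff K E_def by blast
      then have "u = h (Poly_Mapping.single a c + q)" using comb by simp
      moreover have "Poly_Mapping.keys (Poly_Mapping.single a c + q) \<subseteq> insert a A"
        using Poly_Mapping.keys_add[of "Poly_Mapping.single a c" q] q by (auto split: if_splits)
      ultimately show "u \<in> h ` {p. Poly_Mapping.keys p \<subseteq> insert a A}" by blast
    next
      fix u assume "u \<in> h ` {p. Poly_Mapping.keys p \<subseteq> insert a A}"
      then obtain p where p: "Poly_Mapping.keys p \<subseteq> insert a A" "u = h p" by auto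
      \<comment> \<open>Splitting off the term at \<open>a\<close> exhibits \<open>p\<close> as a
        scalar multiple of the new monomial plus a polynomial supported on \<open>A\<close>.\<close>
      define q where "q = p - Poly_Mapping.single a (Poly_Mapping.lookup p a)"
      have "Poly_Mapping.keys q \<subseteq> A"
        using p(1) by (auto simp: q_def in_keys_iff lookup_minus lookup_single when_def split: if_splits)
      moreover have "p = Poly_Mapping.single a (Poly_Mapping.lookup p a) + q" by (simp add: q_def)
      ultimately show "u \<in> h.S.line_extension K v E"
        unfolding h.S.line_extension_mem_iff K E_def p(2) using comb by (metis (mono_tags, lifting) imageI mem_Collect_eq rangeI)
    qed
    ultimately show ?case
      using h.S.dimension.Suc_dim[OF v, of E "card A" K] insert by (simp add: E_def)
  qed
  have "h ` {p. Poly_Mapping.keys p \<subseteq> M} = carrier (R Quot I)"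
  proof
    show "h ` {p. Poly_Mapping.keys p \<subseteq> M} \<subseteq> carrier (R Quot I)"
      using carM h.hom_closed by blast
    show "carrier (R Quot I) \<subseteq> h ` {p. Poly_Mapping.keys p \<subseteq> M}"
      unfolding h_surj
    proof clarify
      fix p assume p: "p \<in> carrier R"
      \<comment> \<open>Spanning: \<open>q\<close> collects the terms of \<open>p\<close> with
        exponent in \<open>M\<close>, and the rest \<open>r\<close> has exponents in
        \<open>U\<close>, so it vanishes in the quotient.\<close>
      define q r where "q = (\<Sum>m\<in>Poly_Mapping.keys p \<inter> M. Poly_Mapping.single m (Poly_Mapping.lookup p m))"
        and "r = p - q"
      have lq: "Poly_Mapping.lookup q m = (if m \<in> M then Poly_Mapping.lookup p m else 0)" for m
        by (auto simp: q_def lookup_sum lookup_single when_def in_keys_iff sum.delta')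
      have q: "Poly_Mapping.keys q \<subseteq> M" by (auto simp: in_keys_iff lq split: if_splits)
      have "Poly_Mapping.keys r \<subseteq> Poly_Mapping.keys p - M"
        by (auto simp: r_def in_keys_iff lookup_minus lq split: if_splits)
      then have r: "r \<in> I" using p by (auto simp: I_def M_def car)
      have "p = r \<oplus>\<^bsub>R\<^esub> q" by (simp add: r_def R_def poly_ring_simps)
      then have "h p = h r \<oplus>\<^bsub>R Quot I\<^esub> h q" using r carM[OF q] I.Icarr by simp
      also have "h r = \<zero>\<^bsub>R Quot I\<^esub>" using h_I[OF r] h.hom_zero by (simp add: R_def poly_ring_simps)
      also have "\<zero>\<^bsub>R Quot I\<^esub> \<oplus>\<^bsub>R Quot I\<^esub> h q = h q" using carM[OF q] by simp
      finally show "h p \<in> h ` {p. Poly_Mapping.keys p \<subseteq> M}" using q by blast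
    qed
  qed
  then show "ring.dimension (R Quot I) (card M) (quot_scalars n I) (carrier (R Quot I))"
    using dim[OF fin order_refl] by (simp add: K_def)
qed

section \<open>Permutation ideals and their Alexander duals\<close>

text \<open>The sum form matches the exponent that \<open>prod_monomials\<close> gives for the
  generator of \<open>\<sigma>\<close>. The same map later turns arbitrary vectors on
  \<open>{1..n}\<close> into exponents.\<close>

definition exponent :: "nat \<Rightarrow> (nat \<Rightarrow> nat) \<Rightarrow> nat \<Rightarrow>\<^sub>0 nat" where
  "exponent n \<sigma> = (\<Sum>i=1..n. Poly_Mapping.single i (\<sigma> i))"

lemma lookup_exponent: "Poly_Mapping.lookup (exponent n \<sigma>) i = (if i \<in> {1..n} then \<sigma> i else 0)"
  by (auto simp: exponent_def lookup_sum lookup_single when_def sum.delta')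

lemma keys_exponent: "Poly_Mapping.keys (exponent n \<sigma>) \<subseteq> {1..n}"
  by (auto simp: in_keys_iff lookup_exponent split: if_splits)

lemma perm_ideal_eq:
  "perm_ideal n S = {p \<in> carrier (poly_ring n :: 'k::field mpoly ring). Poly_Mapping.keys p \<subseteq>
      {m. \<exists>\<sigma>\<in>S. \<forall>i\<in>{1..n}. \<sigma> i \<le> Poly_Mapping.lookup m i}}"
proof -
  have "(\<lambda>\<sigma>. \<Prod>i=1..n. var i ^ \<sigma> i :: 'k mpoly) ` S = (\<lambda>e. Poly_Mapping.single e 1) ` exponent n ` S"
    by (simp add: image_image var_power prod_monomials exponent_def)
  moreover have "(\<forall>i. Poly_Mapping.lookup (exponent n \<sigma>) i \<le> Poly_Mapping.lookup m i) \<longleftrightarrow>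
      (\<forall>i\<in>{1..n}. \<sigma> i \<le> Poly_Mapping.lookup m i)" for \<sigma> m
    by (auto simp: lookup_exponent)
  ultimately show ?thesis
    unfolding perm_ideal_def by (subst (1) \<open>_ ` S = _\<close>, subst genideal_monomials) (auto dest: subsetD[OF keys_exponent])
qed

text \<open>A monomial \<open>c\<close> of the ideal that divides the generator of
  \<open>\<sigma>\<close> lies above some \<open>\<tau>\<close> in \<open>S\<close>. Then
  \<open>\<tau>\<close> is below \<open>\<sigma>\<close> in every coordinate, and equal sums force
  equality throughout.\<close>

lemma min_gens_perm_ideal:
  assumes S: "\<And>\<sigma>. \<sigma> \<in> S \<Longrightarrow> \<sigma> permutes {1..n}"
  shows "min_gens n (perm_ideal n S :: 'k::field mpoly set) = exponent n ` S"
proof -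
  have mem: "Poly_Mapping.single m 1 \<in> (perm_ideal n S :: 'k mpoly set) \<longleftrightarrow>
      Poly_Mapping.keys m \<subseteq> {1..n} \<and> (\<exists>\<sigma>\<in>S. \<forall>i\<in>{1..n}. \<sigma> i \<le> Poly_Mapping.lookup m i)" for m
    by (auto simp: perm_ideal_eq carrier_poly_ring_iff)
  have expo: "Poly_Mapping.single (exponent n \<sigma>) 1 \<in> (perm_ideal n S :: 'k mpoly set)" if "\<sigma> \<in> S" for \<sigma>
    unfolding mem using that keys_exponent by (auto simp: lookup_exponent)
  show ?thesis
  proof (intro Set.set_eqI iffI)
    fix m assume m: "m \<in> min_gens n (perm_ideal n S :: 'k mpoly set)"
    then obtain \<sigma> where \<sigma>: "\<sigma> \<in> S" "\<forall>i\<in>{1..n}. \<sigma> i \<le> Poly_Mapping.lookup m i"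
      by (auto simp: min_gens_def mem)
    then have "exponent n \<sigma> = m"
      using m expo[OF \<sigma>(1)] by (auto simp: min_gens_def lookup_exponent)
    then show "m \<in> exponent n ` S" using \<sigma>(1) by blast
  next
    fix m assume "m \<in> exponent n ` S"
    then obtain \<sigma> where \<sigma>: "\<sigma> \<in> S" "m = exponent n \<sigma>" by blast
    have "c = m" if c: "Poly_Mapping.single c 1 \<in> (perm_ideal n S :: 'k mpoly set)"
      and le: "\<forall>i. Poly_Mapping.lookup c i \<le> Poly_Mapping.lookup m i" for c
    proof -
      obtain \<tau> where \<tau>: "\<tau> \<in> S" "\<forall>i\<in>{1..n}. \<tau> i \<le> Poly_Mapping.lookup c i" using c by (auto simp: mem)
      \<comment> \<open>Both sums are rearrangements of the sum of \<open>1, ..., n\<close>.\<close>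
      have sum: "sum \<tau> {1..n} = sum \<sigma> {1..n}"
        using sum.permute[OF S[OF \<tau>(1)], of id] sum.permute[OF S[OF \<sigma>(1)], of id] by simp
      have cs: "Poly_Mapping.lookup c i \<le> \<sigma> i" if "i \<in> {1..n}" for i
        using le[rule_format, of i] that by (simp add: \<sigma>(2) lookup_exponent)
      have "\<tau> i = \<sigma> i" if "i \<in> {1..n}" for i
        using sum_mono_inv[OF sum _ that] \<tau>(2) cs by (meson finite_atLeastAtMost le_trans)
      show "c = m"
      proof (rule poly_mapping_eqI)
        fix i
        show "Poly_Mapping.lookup c i = Poly_Mapping.lookup m i"
        proof (cases "i \<in> {1..n}")
          case True
          then have "\<sigma> i \<le> Poly_Mapping.lookup c i" using \<tau>(2) \<open>\<And>i. i \<in> {1..n} \<Longrightarrow> \<tau> i = \<sigma> i\<close> by metis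
          then show ?thesis using cs[OF True] True by (simp add: \<sigma>(2) lookup_exponent)
        next
          case False
          then show ?thesis using le[rule_format, of i] by (auto simp: \<sigma>(2) lookup_exponent)
        qed
      qed
    qed
    then show "m \<in> min_gens n (perm_ideal n S :: 'k mpoly set)"
      using expo[OF \<sigma>(1)] keys_exponent[of n \<sigma>] by (auto simp: min_gens_def \<sigma>(2))
  qed
qed

text \<open>The component of \<open>\<sigma>\<close> is generated by pure powers, so a monomial lies
  in it iff some coordinate reaches \<open>n + 1 - \<sigma> i\<close>. Intersecting the components
  puts the quantifier over \<open>S\<close> in front.\<close>

lemma alexander_dual_perm_ideal:
  assumes S: "\<And>\<sigma>. \<sigma> \<in> S \<Longrightarrow> \<sigma> permutes {1..n}"
  shows "alexander_dual n (\<lambda>_. n) (perm_ideal n S) =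
    {p \<in> carrier (poly_ring n :: 'k::field mpoly ring). Poly_Mapping.keys p \<subseteq>
      {m. \<forall>\<sigma>\<in>S. \<exists>i\<in>{1..n}. n < Poly_Mapping.lookup m i + \<sigma> i}}"
proof -
  have comp: "Idl\<^bsub>poly_ring n\<^esub> {var i ^ (n + 1 - Poly_Mapping.lookup (exponent n \<sigma>) i) | i.
        i \<in> {1..n} \<and> Poly_Mapping.lookup (exponent n \<sigma>) i \<ge> 1} =
      {p \<in> carrier (poly_ring n :: 'k mpoly ring). Poly_Mapping.keys p \<subseteq>
        {m. \<exists>i\<in>{1..n}. n < Poly_Mapping.lookup m i + \<sigma> i}}"
    (is "Idl\<^bsub>_\<^esub> ?G = _") if "\<sigma> \<in> S" for \<sigma>
  proof -
    let ?E = "(\<lambda>i. Poly_Mapping.single i (n + 1 - \<sigma> i)) ` {1..n}"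
    \<comment> \<open>Entries of a permutation are positive, so every index in \<open>{1..n}\<close>
      contributes a pure power.\<close>
    have 1: "1 \<le> \<sigma> i" if "i \<in> {1..n}" for i
      using permutes_in_image[OF S[OF \<open>\<sigma> \<in> S\<close>], of i] that by auto
    have "?G = (\<lambda>e. Poly_Mapping.single e 1) ` ?E"
      using 1 by (force simp: var_power lookup_exponent image_image)
    moreover have "(\<forall>j. Poly_Mapping.lookup (Poly_Mapping.single i (n + 1 - \<sigma> i)) j \<le> Poly_Mapping.lookup m j)
        \<longleftrightarrow> n < Poly_Mapping.lookup m i + \<sigma> i" for i and m :: "nat \<Rightarrow>\<^sub>0 nat"
      by (auto simp: lookup_single when_def)
    ultimately show ?thesis by (simp only:) (subst genideal_monomials, auto split: if_splits)
  qed
  have "min_gens n (perm_ideal n S :: 'k mpoly set) = exponent n ` S"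
    using S by (rule min_gens_perm_ideal)
  then show ?thesis
    unfolding alexander_dual_def by (simp only: INT_simps image_image comp cong: INF_cong) auto
qed

text \<open>Negating the membership condition of the dual gives exactly the inequalities of
  \<open>B\<close>. Passing between extensional functions and finitely supported exponents is a
  bijection, so \<open>B\<close> counts the standard monomials.\<close>

lemma dimension_quotient_alexander_dual:
  fixes S :: "(nat \<Rightarrow> nat) set" and n :: nat
  defines "I \<equiv> (alexander_dual n (\<lambda>_. n) (perm_ideal n S) :: 'k::field mpoly set)"
  defines "B \<equiv> {p \<in> {1..n} \<rightarrow>\<^sub>E UNIV. \<exists>\<sigma>\<in>S. \<forall>i\<in>{1..n}. p i + \<sigma> i \<le> n}"
  assumes S: "\<And>\<sigma>. \<sigma> \<in> S \<Longrightarrow> \<sigma> permutes {1..n}" and ne: "S \<noteq> {}"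
  shows "ring (poly_ring n Quot I)" and "subfield (quot_scalars n I) (poly_ring n Quot I)"
    and "ring.dimension (poly_ring n Quot I) (card B) (quot_scalars n I) (carrier (poly_ring n Quot I))"
proof -
  define U :: "(nat \<Rightarrow>\<^sub>0 nat) set"
    where "U = {m. \<forall>\<sigma>\<in>S. \<exists>i\<in>{1..n}. n < Poly_Mapping.lookup m i + \<sigma> i}"
  define M where "M = {m. Poly_Mapping.keys m \<subseteq> {1..n}} - U"
  have I: "I = {p \<in> carrier (poly_ring n). Poly_Mapping.keys p \<subseteq> U}"
    unfolding I_def U_def by (rule alexander_dual_perm_ideal[OF S])
  have bij: "bij_betw (\<lambda>m. restrict (Poly_Mapping.lookup m) {1..n}) M B"
  proof (rule bij_betw_byWitness[of _ "exponent n"])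
    show "\<forall>m\<in>M. exponent n (restrict (Poly_Mapping.lookup m) {1..n}) = m"
      by (auto simp: M_def in_keys_iff lookup_exponent intro!: poly_mapping_eqI)
    show "\<forall>p\<in>B. restrict (Poly_Mapping.lookup (exponent n p)) {1..n} = p"
      by (auto simp: B_def PiE_iff extensional_def lookup_exponent fun_eq_iff)
    show "(\<lambda>m. restrict (Poly_Mapping.lookup m) {1..n}) ` M \<subseteq> B"
      by (fastforce simp: M_def U_def B_def not_less)
    show "exponent n ` B \<subseteq> M"
      using keys_exponent[of n] by (fastforce simp: M_def U_def B_def not_less lookup_exponent)
  qed
  have "B \<subseteq> {1..n} \<rightarrow>\<^sub>E {..n}"
    by (auto simp: B_def PiE_iff extensional_def intro: add_leD1[THEN le_trans])
  then have "finite B" by (rule finite_subset) (simp add: finite_PiE)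
  then have fin: "finite M" using bij_betw_finite[OF bij] by simp
  obtain \<sigma> where "\<sigma> \<in> S" using ne by blast
  then have "\<sigma> i \<le> n" if "i \<in> {1..n}" for i using permutes_in_image[OF S, of \<sigma> i] that by auto
  \<comment> \<open>Since the entries of \<open>\<sigma>\<close> are at most \<open>n\<close>, the
    zero exponent lies outside the component of \<open>\<sigma>\<close>; hence 1 is not in the
    dual.\<close>
  then have "\<not> (\<exists>i\<in>{1..n}. n < Poly_Mapping.lookup 0 i + \<sigma> i)" by (simp add: not_less)
  then have M0: "0 \<in> M" using \<open>\<sigma> \<in> S\<close> unfolding M_def U_def by auto
  have up: "m + d \<in> U" if "m \<in> U" for m d
  proof -
    have "n < Poly_Mapping.lookup m i + \<sigma> i \<Longrightarrow> n < Poly_Mapping.lookup (m + d) i + \<sigma> i" for \<sigma> i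
      by (simp add: lookup_add)
    then show ?thesis using that unfolding U_def by blast
  qed
  note * = dimension_quotient_keys_subset[where ?'k = 'k, of U n, folded M_def I, OF up fin M0]
  show "ring (poly_ring n Quot I)" by (rule *(1))
  show "subfield (quot_scalars n I) (poly_ring n Quot I)" by (rule *(2))
  show "ring.dimension (poly_ring n Quot I) (card B) (quot_scalars n I) (carrier (poly_ring n Quot I))"
    using *(3) bij_betw_same_card[OF bij] by simp
qed

theorem theorem4:
  fixes n b :: nat
    and R :: "'k::field mpoly ring"
    and I :: "'k mpoly set"
  assumes "n \<ge> 1" and "b \<in> {1, 2}"
    and "R = poly_ring n"
    and "I = alexander_dual n (\<lambda>_. n) (perm_ideal n (T b n))"
  shows "ring.finite_dimension (R Quot I) (quot_scalars n I) (carrier (R Quot I)) \<and>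
         card (PF_hat b n) = (ring.dim (R Quot I) over quot_scalars n I) (carrier (R Quot I)) \<and>
         (ring.dim (R Quot I) over quot_scalars n I) (carrier (R Quot I)) = stirling1 (n + 1) 2"
proof -
  have perm: "\<sigma> permutes {1..n}" if "\<sigma> \<in> T b n" for \<sigma>
    using that mem_T_iff[OF assms(2)] by blast
  \<comment> \<open>The permutation with codegree 1 at position \<open>n\<close> serves as a
    witness.\<close>
  have "T b n \<noteq> {}"
    using ex_T_codegree[OF assms(2), of 1 n] assms(1) by auto
  note quot = dimension_quotient_alexander_dual[where ?'k = 'k, OF perm this,
      folded assms(3,4) PF_hat_eq_T[OF assms(2,1)]]
  interpret Q: ring "R Quot I" by (rule quot(1))
  show ?thesis
    using Q.finite_dimensionI[OF quot(3)] Q.dimI[OF quot(2,3)]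
      card_PF_hat[OF assms(2,1)] stirling1_eq_stirling[of "n + 1" 2] by simp
qed

end
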